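(* Let $n\ge 1$ and let $D$ be a deck of $2n$ cards (distinct physical cards), each carrying a rank in $\{1,\dots,2n\}$, ranks possibly repeated. Let $\mathfrak{p}$ be a symmetric winning rule on $D$, and consider the game of $\mathfrak{p}$-war on $D$. Suppose that the initial hand $A(0)$ of player $A$ is uniformly distributed among all subsets of $D$ of a given size $A_0\in\{0,1,\dots,2n\}$. Then the process $(A_t)_{t\ge 0}$, where $A_t=|A(t)|$ is the number of cards held by player $A$ at time $t$, is a simple symmetric random walk on $\{0,1,\dots,2n\}$ started at $A_0$ and stopped upon hitting $0$ or $2n$.
   Context: A winning rule on the deck $D$ is a function $\mathfrak{p}$ assigning to every pair of distinct cards $a\neq b\in D$ and every subset $S\subseteq D\setminus\{a,b\}$ a number $p_{a,b}(S)\ge 0$ such that $p_{a,b}(S)+p_{b,a}(D\setminus(S\cup\{a,b\}))=1$. It is symmetric if $p_{a,b}(S)=p_{a,b}(D\setminus(S\cup\{a,b\}))$ for all such $a,b,S$ (equivalently $p_{a,b}(S)+p_{b,a}(S)=1$). The game of $\mathfrak{p}$-war is the Markov chain on states $(A,B)$ with $A\sqcup B=D$ (the hands of players $A$ and $B$); $(A(t),B(t))$ denotes the state at time $t$. The states $(\emptyset,D)$ and $(D,\emptyset)$ are absorbing. From a non-absorbing state, one draws independently a uniformly random card $a\in A(t)$, a uniformly random card $b\in B(t)$, and $U\sim\mathrm{Unif}([0,1])$; if $U\le p_{a,b}(A(t)\setminus\{a\})$ then $(A(t+1),B(t+1))=(A(t)\cup\{b\},B(t)\setminus\{b\})$, and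 otherwise $(A(t+1),B(t+1))=(A(t)\setminus\{a\},B(t)\cup\{a\})$. *)

theory Defs
  imports "HOL-Probability.Probability"
begin

text \<open>Only the values \<open>p a b S\<close> with \<open>a, b\<close> distinct cards of the deck \<open>D\<close> and
  \<open>S \<subseteq> D - {a, b}\<close> are meaningful; all other values are unconstrained and never used.\<close>

definition winning_rule :: "'c set \<Rightarrow> ('c \<Rightarrow> 'c \<Rightarrow> 'c set \<Rightarrow> real) \<Rightarrow> bool" where
  "winning_rule D p \<longleftrightarrow>
    (\<forall>a\<in>D. \<forall>b\<in>D. \<forall>S. a \<noteq> b \<longrightarrow> S \<subseteq> D - {a, b} \<longrightarrow>
      p a b S \<ge> 0 \<and> p a b S + p b a (D - (S \<union> {a, b})) = 1)"

definition symmetric_rule :: "'c set \<Rightarrow> ('c \<Rightarrow> 'c \<Rightarrow> 'c set \<Rightarrow> real) \<Rightarrow> bool" where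
  "symmetric_rule D p \<longleftrightarrow>
    (\<forall>a\<in>D. \<forall>b\<in>D. \<forall>S. a \<noteq> b \<longrightarrow> S \<subseteq> D - {a, b} \<longrightarrow>
      p a b S = p a b (D - (S \<union> {a, b})))"

definition war_states :: "'c set \<Rightarrow> ('c set \<times> 'c set) set" where
  "war_states D = {(A, B). A \<union> B = D \<and> A \<inter> B = {}}"

text \<open>The Boolean \<open>w\<close> records the event \<open>U \<le> p a b (A - {a})\<close> for \<open>U\<close> uniform on \<open>[0, 1]\<close>,
  independent of the two drawn cards.\<close>

definition war_step ::
    "('c \<Rightarrow> 'c \<Rightarrow> 'c set \<Rightarrow> real) \<Rightarrow> 'c set \<times> 'c set \<Rightarrow> ('c set \<times> 'c set) pmf" where
  "war_step p = (\<lambda>(A, B).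
    if A = {} \<or> B = {} then return_pmf (A, B)
    else do {
      a \<leftarrow> pmf_of_set A;
      b \<leftarrow> pmf_of_set B;
      w \<leftarrow> bernoulli_pmf (measure (uniform_measure lborel {0..1}) {u. u \<le> p a b (A - {a})});
      return_pmf (if w then (A \<union> {b}, B - {b}) else (A - {a}, B \<union> {a}))
    })"

text \<open>A time-homogeneous Markov chain on a set \<open>\<Omega>\<close> of states, with transition kernel \<open>K\<close>
  and arbitrary initial distribution.\<close>

definition markov_chain ::
    "'w measure \<Rightarrow> 's set \<Rightarrow> ('s \<Rightarrow> 's pmf) \<Rightarrow> (nat \<Rightarrow> 'w \<Rightarrow> 's) \<Rightarrow> bool" where
  "markov_chain M \<Omega> K X \<longleftrightarrow>
    prob_space M \<and>
    (\<forall>t. X t \<in> measurable M (count_space \<Omega>)) \<and>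
    (\<forall>t s s'. \<P>(\<omega> in M. \<forall>i\<le>t. X i \<omega> = s i) > 0 \<longrightarrow>
      \<P>(\<omega> in M. X (Suc t) \<omega> = s' \<bar> \<forall>i\<le>t. X i \<omega> = s i) = pmf (K (s t)) s')"

definition war_game ::
    "'w measure \<Rightarrow> 'c set \<Rightarrow> ('c \<Rightarrow> 'c \<Rightarrow> 'c set \<Rightarrow> real) \<Rightarrow>
      (nat \<Rightarrow> 'w \<Rightarrow> 'c set \<times> 'c set) \<Rightarrow> bool" where
  "war_game M D p X \<longleftrightarrow> markov_chain M (war_states D) (war_step p) X"

definition steps_space :: "(nat \<Rightarrow> int) measure" where
  "steps_space = (\<Pi>\<^sub>M i\<in>UNIV. measure_pmf (pmf_of_set {-1, 1}))"

definition walk :: "int \<Rightarrow> nat \<Rightarrow> (nat \<Rightarrow> int) \<Rightarrow> int" where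
  "walk x t \<xi> = x + (\<Sum>i<t. \<xi> i)"

text \<open>The least \<open>s\<close> with \<open>s = t\<close> or \<open>S s \<in> H\<close> is the minimum of \<open>t\<close> and the hitting time
  of \<open>H\<close>, also when \<open>H\<close> is never hit.\<close>

definition stopped_at_hitting :: "'s set \<Rightarrow> (nat \<Rightarrow> 'w \<Rightarrow> 's) \<Rightarrow> nat \<Rightarrow> 'w \<Rightarrow> 's" where
  "stopped_at_hitting H S t \<omega> = S (LEAST s. s = t \<or> S s \<omega> \<in> H) \<omega>"

text \<open>Equality in law of the whole process \<open>Y\<close>, as a random element of the sequence space, with
  the simple symmetric random walk started at \<open>x\<close> and stopped upon hitting \<open>H\<close>.\<close>

definition stopped_simple_symmetric_walk ::
    "'w measure \<Rightarrow> int set \<Rightarrow> int \<Rightarrow> (nat \<Rightarrow> 'w \<Rightarrow> int) \<Rightarrow> bool" where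
  "stopped_simple_symmetric_walk M H x Y \<longleftrightarrow>
    prob_space M \<and>
    (\<forall>t. Y t \<in> measurable M (count_space UNIV)) \<and>
    distr M (\<Pi>\<^sub>M t\<in>UNIV. count_space UNIV) (\<lambda>\<omega> t. Y t \<omega>) =
    distr steps_space (\<Pi>\<^sub>M t\<in>UNIV. count_space UNIV)
      (\<lambda>\<xi> t. stopped_at_hitting H (walk x) t \<xi>)"

end

(* The war chain and the stopped walk are intertwined by the kernel that sends z to a uniformly random
   hand of size z. Indeed, if A is uniform of size k and a, b are the drawn cards, then (A - {a}, a, b)
   is uniform among all triples (C, a, b) with |C| = k - 1 and a, b distinct cards outside C. Swapping
   a and b preserves this law and the two possible new hands C + a + b and C, and for a symmetric rule it
   exchanges the probabilities of winning and losing. So the move is decided by a fair coin independent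
   of C and {a, b}, and the new hand is again uniform given its size. *)

theory Submission
  imports Defs
begin

subsection \<open>Path laws and functions of Markov chains\<close>

text \<open>For a fixed hand the next round is usually far from fair: if the higher card always
  wins, a hand made of the top cards never loses a card. So the count cannot be obtained by lumping
  states of equal size, and fairness holds only on average over a uniform hand. That average must
  survive conditioning on the entire past of the counts, not only on the current one, since the
  claim concerns the law of the whole process. Hence the induction carries the joint law of the
  count history and the current hand; a fair coin alone would not sustain it, because the new hand
  must again be uniform after a win and after a loss separately. The uniform initial hand is the
  base case, and at the absorbing sizes only one hand exists. The count and the stopped walk are
  never coupled: both assign the same product of transition probabilities to every finite
  path.\<close>

lemma distr_eq_if_path_probabilities_eq:
  fixes Y :: "nat \<Rightarrow> 'w \<Rightarrow> 'a::countable" and Z :: "nat \<Rightarrow> 'v \<Rightarrow> 'a"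
  assumes M: "prob_space M" and N: "prob_space N"
    and Y[measurable]: "\<And>t. Y t \<in> measurable M (count_space UNIV)"
    and Z[measurable]: "\<And>t. Z t \<in> measurable N (count_space UNIV)"
    and eq: "\<And>t y. measure M {\<omega> \<in> space M. \<forall>i\<le>t. Y i \<omega> = y i} =
      measure N {\<omega> \<in> space N. \<forall>i\<le>t. Z i \<omega> = y i}"
  shows "distr M (\<Pi>\<^sub>M t\<in>UNIV. count_space UNIV) (\<lambda>\<omega> t. Y t \<omega>) =
    distr N (\<Pi>\<^sub>M t\<in>UNIV. count_space UNIV) (\<lambda>\<omega> t. Z t \<omega>)"
proof -
  interpret M: prob_space M by fact
  interpret N: prob_space N by fact
  \<comment> \<open>Lists over a countable type are countable, so measurability and equality of the
    laws of \<open>V t\<close> and \<open>W t\<close> can be tested on singletons. A singleton is a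
    path event, or has empty preimage when its length is wrong.\<close>
  define V where "V t \<omega> = map (\<lambda>i. Y i \<omega>) [0..<Suc t]" for t \<omega>
  define W where "W t \<omega> = map (\<lambda>i. Z i \<omega>) [0..<Suc t]" for t \<omega>
  have path_iff: "map f [0..<Suc t] = l \<longleftrightarrow> length l = Suc t \<and> (\<forall>i\<le>t. f i = l ! i)"
    for f :: "nat \<Rightarrow> 'a" and t l
    by (auto simp: list_eq_iff_nth_eq less_Suc_eq_le simp del: upt_Suc)
  have V[measurable]: "V t \<in> measurable M (count_space UNIV)" for t
    unfolding measurable_count_space_eq2_countable
  proof safe
    fix l
    have "V t -` {l} \<inter> space M = {\<omega> \<in> space M. length l = Suc t \<and> (\<forall>i\<le>t. Y i \<omega> = l ! i)}"
      by (auto simp: V_def path_iff simp del: upt_Suc)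
    then show "V t -` {l} \<inter> space M \<in> sets M" by simp
  qed simp
  have W[measurable]: "W t \<in> measurable N (count_space UNIV)" for t
    unfolding measurable_count_space_eq2_countable
  proof safe
    fix l
    have "W t -` {l} \<inter> space N = {\<omega> \<in> space N. length l = Suc t \<and> (\<forall>i\<le>t. Z i \<omega> = l ! i)}"
      by (auto simp: W_def path_iff simp del: upt_Suc)
    then show "W t -` {l} \<inter> space N \<in> sets N" by simp
  qed simp
  have VW: "distr M (count_space UNIV) (V t) = distr N (count_space UNIV) (W t)" for t
  proof (rule measure_eqI_countable[of _ UNIV])
    fix l
    have "measure M (V t -` {l} \<inter> space M) = measure N (W t -` {l} \<inter> space N)"
    proof (cases "length l = Suc t")
      case True
      then have "V t -` {l} \<inter> space M = {\<omega> \<in> space M. \<forall>i\<le>t. Y i \<omega> = l ! i}"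
        "W t -` {l} \<inter> space N = {\<omega> \<in> space N. \<forall>i\<le>t. Z i \<omega> = l ! i}"
        by (auto simp: V_def W_def path_iff simp del: upt_Suc)
      then show ?thesis by (simp add: eq)
    next
      case False
      then have "V t -` {l} \<inter> space M = {}" "W t -` {l} \<inter> space N = {}"
        by (auto simp: V_def W_def)
      then show ?thesis by simp
    qed
    then show "emeasure (distr M (count_space UNIV) (V t)) {l} =
        emeasure (distr N (count_space UNIV) (W t)) {l}"
      by (simp add: emeasure_distr M.emeasure_eq_measure N.emeasure_eq_measure)
  qed auto
  have Y': "(\<lambda>\<omega> t. Y t \<omega>) \<in> measurable M (\<Pi>\<^sub>M t\<in>UNIV. count_space UNIV)"
    and Z': "(\<lambda>\<omega> t. Z t \<omega>) \<in> measurable N (\<Pi>\<^sub>M t\<in>UNIV. count_space UNIV)"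
    using measurable_PiM_single'[of UNIV Y M "\<lambda>_. count_space UNIV"]
      measurable_PiM_single'[of UNIV Z N "\<lambda>_. count_space UNIV"] by auto
  show ?thesis
  proof (rule measure_eqI_PiM_infinite)
    show "finite_measure (distr M (\<Pi>\<^sub>M t\<in>UNIV. count_space UNIV) (\<lambda>\<omega> t. Y t \<omega>))"
      using M.prob_space_distr[OF Y'] prob_space.finite_measure by blast
  next
    fix A :: "nat \<Rightarrow> 'a set" and J :: "nat set"
    assume J: "finite J"
    let ?E = "prod_emb UNIV (\<lambda>_. count_space UNIV) J (Pi\<^sub>E J A)"
    have E: "?E = {f. \<forall>j\<in>J. f j \<in> A j}"
      by (auto simp: prod_emb_def PiE_iff)
    have E_sets: "?E \<in> sets (\<Pi>\<^sub>M t\<in>UNIV. count_space UNIV)"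
      using J by (intro sets_PiM_I) auto
    \<comment> \<open>A cylinder constrains finitely many times; with \<open>t\<close> beyond all of
      them it becomes an event about the lists \<open>V t\<close> and \<open>W t\<close>.\<close>
    obtain t where t: "\<And>j. j \<in> J \<Longrightarrow> j < Suc t"
      using finite_nat_set_iff_bounded[of J] J less_SucI by blast
    let ?L = "{l. \<forall>j\<in>J. l ! j \<in> A j}"
    have "(\<lambda>\<omega> t. Y t \<omega>) -` ?E \<inter> space M = V t -` ?L \<inter> space M"
      "(\<lambda>\<omega> t. Z t \<omega>) -` ?E \<inter> space N = W t -` ?L \<inter> space N"
      using t by (auto simp: E V_def W_def simp del: upt_Suc)
    then show "emeasure (distr M (\<Pi>\<^sub>M t\<in>UNIV. count_space UNIV) (\<lambda>\<omega> t. Y t \<omega>)) ?E =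
        emeasure (distr N (\<Pi>\<^sub>M t\<in>UNIV. count_space UNIV) (\<lambda>\<omega> t. Z t \<omega>)) ?E"
      using arg_cong[OF VW, of "\<lambda>m. emeasure m ?L" t] E_sets Y' Z'
      by (simp add: emeasure_distr)
  qed auto
qed

text \<open>Probability that the chain with kernel \<open>\<kappa>\<close> started at
  \<open>x\<close> follows \<open>y\<close> up to time \<open>t\<close>. The product form avoids
  conditioning on null histories.\<close>

definition path_weight :: "'a \<Rightarrow> ('a \<Rightarrow> 'a pmf) \<Rightarrow> nat \<Rightarrow> (nat \<Rightarrow> 'a) \<Rightarrow> real" where
  "path_weight x \<kappa> t y = of_bool (y 0 = x) * (\<Prod>i<t. pmf (\<kappa> (y i)) (y (Suc i)))"

lemma path_weight_0 [simp]: "path_weight x \<kappa> 0 y = of_bool (y 0 = x)"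
  by (simp add: path_weight_def)

lemma path_weight_Suc [simp]:
  "path_weight x \<kappa> (Suc t) y = path_weight x \<kappa> t y * pmf (\<kappa> (y t)) (y (Suc t))"
  by (simp add: path_weight_def)

text \<open>The intertwining is available only on the closed set \<open>I\<close>; this disposes of
  paths ending outside it. Either the path was already outside one step earlier, or its last step
  leaves \<open>I\<close> and contributes a zero factor.\<close>

lemma path_weight_eq_0:
  assumes "x \<in> I" and "\<And>z. z \<in> I \<Longrightarrow> set_pmf (\<kappa> z) \<subseteq> I" and "y t \<notin> I"
  shows "path_weight x \<kappa> t y = 0"
  using assms(3)
proof (induction t)
  case (Suc t)
  show ?case
  proof (cases "y t \<in> I")
    case True
    with Suc.prems assms(2) have "pmf (\<kappa> (y t)) (y (Suc t)) = 0"
      by (auto simp: pmf_eq_0_set_pmf)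
    then show ?thesis by simp
  qed (simp add: Suc.IH)
qed (use assms(1) in auto)

lemma pred_count_space:
  "X \<in> measurable M (count_space \<Omega>) \<Longrightarrow> Measurable.pred M (\<lambda>\<omega>. P (X \<omega>))"
  by (rule measurable_compose[of X M "count_space \<Omega>"]) simp_all

text \<open>The definition of a chain conditions on a fully specified history, whereas a count
  history only says that each past state lies in some set. Such an event splits into finitely many
  full histories ending in \<open>s\<close>, and all of them share the factor
  \<open>pmf (K s) s'\<close>.\<close>

lemma markov_chain_step:
  assumes chain: "markov_chain M \<Omega> K X" and "finite \<Omega>"
  shows "measure M {\<omega> \<in> space M. (\<forall>i\<le>t. X i \<omega> \<in> F i) \<and> X t \<omega> = s \<and> X (Suc t) \<omega> = s'} =
    measure M {\<omega> \<in> space M. (\<forall>i\<le>t. X i \<omega> \<in> F i) \<and> X t \<omega> = s} * pmf (K s) s'"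
proof -
  interpret prob_space M using chain by (simp add: markov_chain_def)
  have X: "X i \<in> measurable M (count_space \<Omega>)" for i
    using chain by (simp add: markov_chain_def)
  note [measurable] = pred_count_space[OF X]
  have X_\<Omega>: "X i \<omega> \<in> \<Omega>" if "\<omega> \<in> space M" for i \<omega>
    using measurable_space[OF X that] by simp
  \<comment> \<open>Intersecting with \<open>\<Omega>\<close> keeps the set of histories finite; the
    last coordinate is pinned to \<open>s\<close>.\<close>
  define G where "G i = (if i = t then F i \<inter> {s} else F i) \<inter> \<Omega>" for i
  define P where "P = Pi\<^sub>E {..t} G"
  have fin: "finite P"
    unfolding P_def G_def using \<open>finite \<Omega>\<close> by (intro finite_PiE) auto
  define E where "E r = {\<omega> \<in> space M. \<forall>i\<le>t. X i \<omega> = r i}" for r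
  have E_sets: "E r \<in> sets M" for r
    unfolding E_def by measurable
  have disj: "disjoint_family_on E P"
    unfolding disjoint_family_on_def E_def P_def
  proof (intro ballI impI)
    fix r r' assume "r \<in> Pi\<^sub>E {..t} G" "r' \<in> Pi\<^sub>E {..t} G" "r \<noteq> r'"
    then obtain i where "i \<le> t" "r i \<noteq> r' i"
      using PiE_ext[of r "{..t}" G r'] by auto
    then show "{\<omega> \<in> space M. \<forall>i\<le>t. X i \<omega> = r i} \<inter> {\<omega> \<in> space M. \<forall>i\<le>t. X i \<omega> = r' i} = {}"
      by auto
  qed
  have mem_P: "restrict (\<lambda>i. X i \<omega>) {..t} \<in> P"
    if "\<omega> \<in> space M" "\<forall>i\<le>t. X i \<omega> \<in> F i" "X t \<omega> = s" for \<omega>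
    using that X_\<Omega> by (auto simp: P_def G_def)
  have P_D: "r t = s" "\<forall>i\<le>t. r i \<in> F i" if "r \<in> P" for r
  proof -
    have r: "r i \<in> (if i = t then F i \<inter> {s} else F i)" if "i \<le> t" for i
      using PiE_mem[of r "{..t}" G i] that \<open>r \<in> P\<close> by (auto simp: P_def G_def split: if_splits)
    show "r t = s" using r[of t] by simp
    show "\<forall>i\<le>t. r i \<in> F i" using r by (metis IntE)
  qed
  have Un: "{\<omega> \<in> space M. (\<forall>i\<le>t. X i \<omega> \<in> F i) \<and> X t \<omega> = s} = (\<Union>r\<in>P. E r)"
    (is "?A = ?B")
  proof (rule set_eqI)
    fix \<omega>
    show "\<omega> \<in> ?A \<longleftrightarrow> \<omega> \<in> ?B"
    proof
      assume "\<omega> \<in> ?A"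
      then show "\<omega> \<in> ?B"
        using mem_P[of \<omega>] by (intro UN_I[of "restrict (\<lambda>i. X i \<omega>) {..t}"]) (auto simp: E_def)
    next
      assume "\<omega> \<in> ?B"
      then show "\<omega> \<in> ?A" using P_D by (auto simp: E_def)
    qed
  qed
  let ?S = "{\<omega> \<in> space M. X (Suc t) \<omega> = s'}"
  have step: "measure M (E r \<inter> ?S) = measure M (E r) * pmf (K s) s'" if "r \<in> P" for r
  proof (cases "measure M (E r) > 0")
    case True
    then have "\<P>(\<omega> in M. X (Suc t) \<omega> = s' \<bar> \<forall>i\<le>t. X i \<omega> = r i) = pmf (K (r t)) s'"
      using chain unfolding markov_chain_def E_def by blast
    moreover have "{\<omega> \<in> space M. X (Suc t) \<omega> = s' \<and> (\<forall>i\<le>t. X i \<omega> = r i)} = E r \<inter> ?S"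
      by (auto simp: E_def)
    ultimately show ?thesis
      using True P_D[OF that] by (simp add: cond_prob_def E_def[symmetric] field_simps)
  next
    \<comment> \<open>The Markov property is silent about null histories, but there both sides
      vanish.\<close>
    case False
    then have "measure M (E r) = 0" by (meson measure_nonneg antisym_conv1 not_less)
    moreover have "measure M (E r \<inter> ?S) \<le> measure M (E r)"
      using E_sets by (intro finite_measure_mono) auto
    ultimately show ?thesis using measure_nonneg[of M "E r \<inter> ?S"] by simp
  qed
  have "{\<omega> \<in> space M. (\<forall>i\<le>t. X i \<omega> \<in> F i) \<and> X t \<omega> = s \<and> X (Suc t) \<omega> = s'} =
      {\<omega> \<in> space M. (\<forall>i\<le>t. X i \<omega> \<in> F i) \<and> X t \<omega> = s} \<inter> ?S"
    by auto
  also have "\<dots> = (\<Union>r\<in>P. E r \<inter> ?S)"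
    unfolding Un by blast
  also have "measure M \<dots> = (\<Sum>r\<in>P. measure M (E r \<inter> ?S))"
    using E_sets disj
    by (intro finite_measure_finite_Union fin) (auto simp: disjoint_family_on_def)
  also have "\<dots> = (\<Sum>r\<in>P. measure M (E r)) * pmf (K s) s'"
    by (simp add: step sum_distrib_right)
  also have "(\<Sum>r\<in>P. measure M (E r)) = measure M (\<Union>r\<in>P. E r)"
    using E_sets disj by (intro finite_measure_finite_Union[symmetric] fin) auto
  finally show ?thesis by (simp add: Un)
qed

section \<open>Functions of a Markov chain via intertwining\<close>

lemma pmf_bind_finite:
  assumes "finite S" and "set_pmf p \<subseteq> S"
  shows "pmf (bind_pmf p f) y = (\<Sum>x\<in>S. pmf p x * pmf (f x) y)"
  unfolding pmf_bind using assms by (subst integral_measure_pmf[of S]) auto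

text \<open>The Rogers-Pitman criterion: the intertwining relation makes the law \<open>\<Lambda> z\<close> of the hidden
  state, given that the observed history ends in \<open>z\<close>, reproduce itself from step to step.\<close>

lemma intertwining_joint_law:
  fixes f :: "'s \<Rightarrow> 'a"
  assumes chain: "markov_chain M \<Omega> K X" and "finite \<Omega>"
    and \<Lambda>_\<Omega>: "\<And>z. z \<in> I \<Longrightarrow> set_pmf (\<Lambda> z) \<subseteq> \<Omega>"
    and \<Lambda>_fibre: "\<And>z s. z \<in> I \<Longrightarrow> s \<in> set_pmf (\<Lambda> z) \<Longrightarrow> f s = z"
    and \<kappa>_I: "\<And>z. z \<in> I \<Longrightarrow> set_pmf (\<kappa> z) \<subseteq> I"
    and intertw: "\<And>z. z \<in> I \<Longrightarrow> bind_pmf (\<Lambda> z) K = bind_pmf (\<kappa> z) \<Lambda>"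
    and "x \<in> I" and init: "\<And>s. measure M {\<omega> \<in> space M. X 0 \<omega> = s} = pmf (\<Lambda> x) s"
    and f_I: "f ` \<Omega> \<subseteq> I" and s: "s \<in> \<Omega>"
  shows "measure M {\<omega> \<in> space M. (\<forall>i\<le>t. f (X i \<omega>) = y i) \<and> X t \<omega> = s} =
    path_weight x \<kappa> t y * of_bool (f s = y t) * pmf (\<Lambda> (f s)) s"
  using s
proof (induction t arbitrary: s)
  case 0
  have "{\<omega> \<in> space M. (\<forall>i\<le>0. f (X i \<omega>) = y i) \<and> X 0 \<omega> = s} =
      (if f s = y 0 then {\<omega> \<in> space M. X 0 \<omega> = s} else {})"
    by auto
  \<comment> \<open>Fibres are disjoint, so \<open>\<Lambda> x\<close> charges \<open>s\<close> only
    if \<open>x = f s\<close>.\<close>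
  moreover have "pmf (\<Lambda> x) s = of_bool (f s = x) * pmf (\<Lambda> (f s)) s"
    using \<Lambda>_fibre[OF \<open>x \<in> I\<close>, of s] by (auto simp: pmf_eq_0_set_pmf)
  ultimately show ?case by (auto simp: init)
next
  case (Suc t)
  interpret prob_space M using chain by (simp add: markov_chain_def)
  have X: "X i \<in> measurable M (count_space \<Omega>)" for i
    using chain by (simp add: markov_chain_def)
  note [measurable] = pred_count_space[OF X]
  have X_\<Omega>: "X i \<omega> \<in> \<Omega>" if "\<omega> \<in> space M" for i \<omega>
    using measurable_space[OF X that] by simp
  have fs: "f s \<in> I" using Suc.prems f_I by auto
  show ?case
  proof (cases "f s = y (Suc t)")
    case False
    then have "{\<omega> \<in> space M. (\<forall>i\<le>Suc t. f (X i \<omega>) = y i) \<and> X (Suc t) \<omega> = s} = {}" by auto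
    then show ?thesis unfolding \<open>_ = {}\<close> using False by simp
  next
    case True
    define A where "A r = {\<omega> \<in> space M. (\<forall>i\<le>t. X i \<omega> \<in> f -` {y i}) \<and> X t \<omega> = r \<and> X (Suc t) \<omega> = s}" for r
    have A_sets: "A r \<in> sets M" for r unfolding A_def by measurable
    have "{\<omega> \<in> space M. (\<forall>i\<le>Suc t. f (X i \<omega>) = y i) \<and> X (Suc t) \<omega> = s} = (\<Union>r\<in>\<Omega>. A r)"
      using X_\<Omega> True by (auto simp: A_def le_Suc_eq)
    also have "measure M \<dots> = (\<Sum>r\<in>\<Omega>. measure M (A r))"
      using A_sets by (intro finite_measure_finite_Union \<open>finite \<Omega>\<close>)
        (auto simp: disjoint_family_on_def A_def)
    also have "\<dots> = (\<Sum>r\<in>\<Omega>. path_weight x \<kappa> t y * of_bool (f r = y t) * pmf (\<Lambda> (f r)) r * pmf (K r) s)"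
    proof (rule sum.cong)
      fix r assume "r \<in> \<Omega>"
      then show "measure M (A r) =
          path_weight x \<kappa> t y * of_bool (f r = y t) * pmf (\<Lambda> (f r)) r * pmf (K r) s"
        using markov_chain_step[OF chain \<open>finite \<Omega>\<close>, of t "\<lambda>i. f -` {y i}" r s] Suc.IH[of r]
        by (simp add: A_def)
    qed simp
    also have "\<dots> = path_weight x \<kappa> (Suc t) y * pmf (\<Lambda> (f s)) s"
    proof (cases "y t \<in> I")
      case False
      then show ?thesis
        using path_weight_eq_0[of x I \<kappa> y t] \<open>x \<in> I\<close> \<kappa>_I by simp
    next
      case yI: True
      \<comment> \<open>The law \<open>\<Lambda> (y t)\<close> lives on the fibre of
        \<open>y t\<close>, so the indicator can be absorbed and the sum runs over all of
        \<open>\<Omega>\<close>.\<close>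
      have *: "of_bool (f r = y t) * (pmf (\<Lambda> (f r)) r * c) = pmf (\<Lambda> (y t)) r * c" for r c
        using \<Lambda>_fibre[OF yI, of r] by (auto simp: pmf_eq_0_set_pmf)
      \<comment> \<open>Intertwining replaces a hidden step from \<open>\<Lambda> (y t)\<close> by
        an observed step followed by resampling the hidden state. Only the observed value
        \<open>f s\<close> can resample to \<open>s\<close>, so a single term remains.\<close>
      have "(\<Sum>r\<in>\<Omega>. pmf (\<Lambda> (y t)) r * pmf (K r) s) = pmf (bind_pmf (\<kappa> (y t)) \<Lambda>) s"
        using pmf_bind_finite[OF \<open>finite \<Omega>\<close> \<Lambda>_\<Omega>[OF yI], of K s] by (simp add: intertw[OF yI])
      also have "\<dots> = pmf (\<kappa> (y t)) (f s) * pmf (\<Lambda> (f s)) s"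
        unfolding pmf_bind
      proof (subst integral_measure_pmf[of "{f s}"])
        fix z assume "z \<in> set_pmf (\<kappa> (y t))" "pmf (\<Lambda> z) s \<noteq> 0"
        then show "z \<in> {f s}"
          using \<kappa>_I[OF yI] \<Lambda>_fibre[of z s] by (auto simp: pmf_eq_0_set_pmf)
      qed auto
      finally have "(\<Sum>r\<in>\<Omega>. pmf (\<Lambda> (y t)) r * pmf (K r) s) =
        pmf (\<kappa> (y t)) (f s) * pmf (\<Lambda> (f s)) s" .
      then show ?thesis
        using True by (simp only: mult.assoc * sum_distrib_left[symmetric] path_weight_Suc)
    qed
    finally show ?thesis using True by simp
  qed
qed

text \<open>Summing the joint law over the hidden state removes it, because
  \<open>\<Lambda> (y t)\<close> has total mass one.\<close>

lemma intertwining_path_probability: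
  fixes f :: "'s \<Rightarrow> 'a"
  assumes chain: "markov_chain M \<Omega> K X" and "finite \<Omega>"
    and \<Lambda>_\<Omega>: "\<And>z. z \<in> I \<Longrightarrow> set_pmf (\<Lambda> z) \<subseteq> \<Omega>"
    and \<Lambda>_fibre: "\<And>z s. z \<in> I \<Longrightarrow> s \<in> set_pmf (\<Lambda> z) \<Longrightarrow> f s = z"
    and \<kappa>_I: "\<And>z. z \<in> I \<Longrightarrow> set_pmf (\<kappa> z) \<subseteq> I"
    and intertw: "\<And>z. z \<in> I \<Longrightarrow> bind_pmf (\<Lambda> z) K = bind_pmf (\<kappa> z) \<Lambda>"
    and "x \<in> I" and init: "\<And>s. measure M {\<omega> \<in> space M. X 0 \<omega> = s} = pmf (\<Lambda> x) s"
    and f_I: "f ` \<Omega> \<subseteq> I"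
  shows "measure M {\<omega> \<in> space M. \<forall>i\<le>t. f (X i \<omega>) = y i} = path_weight x \<kappa> t y"
proof -
  interpret prob_space M using chain by (simp add: markov_chain_def)
  have X: "X i \<in> measurable M (count_space \<Omega>)" for i
    using chain by (simp add: markov_chain_def)
  note [measurable] = pred_count_space[OF X]
  have X_\<Omega>: "X i \<omega> \<in> \<Omega>" if "\<omega> \<in> space M" for i \<omega>
    using measurable_space[OF X that] by simp
  define A where "A r = {\<omega> \<in> space M. (\<forall>i\<le>t. f (X i \<omega>) = y i) \<and> X t \<omega> = r}" for r
  have A_sets: "A r \<in> sets M" for r unfolding A_def by measurable
  have "{\<omega> \<in> space M. \<forall>i\<le>t. f (X i \<omega>) = y i} = (\<Union>r\<in>\<Omega>. A r)"
    using X_\<Omega> by (auto simp: A_def)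
  also have "measure M \<dots> = (\<Sum>r\<in>\<Omega>. measure M (A r))"
    using A_sets by (intro finite_measure_finite_Union \<open>finite \<Omega>\<close>)
      (auto simp: disjoint_family_on_def A_def)
  also have "\<dots> = (\<Sum>r\<in>\<Omega>. path_weight x \<kappa> t y * of_bool (f r = y t) * pmf (\<Lambda> (f r)) r)"
    unfolding A_def using assms by (intro sum.cong refl intertwining_joint_law[of M \<Omega> K X I]) auto
  also have "\<dots> = path_weight x \<kappa> t y"
  proof (cases "y t \<in> I")
    case False
    then show ?thesis
      using path_weight_eq_0[of x I \<kappa> y t] \<open>x \<in> I\<close> \<kappa>_I by simp
  next
    case yI: True
    have "of_bool (f r = y t) * pmf (\<Lambda> (f r)) r = pmf (\<Lambda> (y t)) r" for r
      using \<Lambda>_fibre[OF yI, of r] by (auto simp: pmf_eq_0_set_pmf)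
    then show ?thesis
      using sum_pmf_eq_1[OF \<open>finite \<Omega>\<close> \<Lambda>_\<Omega>[OF yI]]
      by (simp only: mult.assoc sum_distrib_left[symmetric])
  qed
  finally show ?thesis .
qed

subsection \<open>The stopped walk\<close>

definition stopped_walk_kernel :: "int set \<Rightarrow> int \<Rightarrow> int pmf" where
  "stopped_walk_kernel H z =
    (if z \<in> H then return_pmf z else map_pmf ((+) z) (pmf_of_set {-1, 1}))"

lemma stopped_at_hitting_0: "stopped_at_hitting H S 0 \<omega> = S 0 \<omega>"
proof -
  have "(LEAST s. s = 0 \<or> S s \<omega> \<in> H) = 0" by (rule Least_equality) auto
  then show ?thesis by (simp add: stopped_at_hitting_def)
qed

lemma stopped_at_hitting_eq_if_notin:
  assumes "stopped_at_hitting H S t \<omega> \<notin> H"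
  shows "stopped_at_hitting H S t \<omega> = S t \<omega>" and "s \<le> t \<Longrightarrow> S s \<omega> \<notin> H"
proof -
  let ?\<tau> = "LEAST s. s = t \<or> S s \<omega> \<in> H"
  have "?\<tau> = t \<or> S ?\<tau> \<omega> \<in> H" by (rule LeastI[of _ t]) simp
  \<comment> \<open>Were the minimum not \<open>t\<close>, it would be a hitting time and the
    stopped value would lie in \<open>H\<close>.\<close>
  with assms have \<tau>: "?\<tau> = t" by (auto simp: stopped_at_hitting_def)
  then show "stopped_at_hitting H S t \<omega> = S t \<omega>" by (simp add: stopped_at_hitting_def)
  then show "S s \<omega> \<notin> H" if "s \<le> t"
    using assms not_less_Least[of s "\<lambda>s. s = t \<or> S s \<omega> \<in> H"] \<tau> that by (cases "s = t") auto
qed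

text \<open>Turns the \<open>LEAST\<close> into a pathwise recursion. If the stopped value is in
  \<open>H\<close>, raising the bound to \<open>Suc t\<close> does not move the minimum; otherwise
  no time up to \<open>t\<close> hits \<open>H\<close>, and the minimum is \<open>Suc t\<close>
  whether or not that time hits.\<close>

lemma stopped_at_hitting_Suc:
  "stopped_at_hitting H S (Suc t) \<omega> =
    (if stopped_at_hitting H S t \<omega> \<in> H then stopped_at_hitting H S t \<omega> else S (Suc t) \<omega>)"
proof (cases "stopped_at_hitting H S t \<omega> \<in> H")
  case True
  let ?\<tau> = "LEAST s. s = t \<or> S s \<omega> \<in> H"
  have "(LEAST s. s = Suc t \<or> S s \<omega> \<in> H) = ?\<tau>"
  proof (rule Least_equality)
    show "?\<tau> = Suc t \<or> S ?\<tau> \<omega> \<in> H" using True by (simp add: stopped_at_hitting_def)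
  next
    fix s assume "s = Suc t \<or> S s \<omega> \<in> H"
    moreover have "?\<tau> \<le> t" by (rule Least_le) simp
    ultimately show "?\<tau> \<le> s" using Least_le[of "\<lambda>s. s = t \<or> S s \<omega> \<in> H" s] by auto
  qed
  with True show ?thesis by (simp add: stopped_at_hitting_def)
next
  case False
  have "(LEAST s. s = Suc t \<or> S s \<omega> \<in> H) = Suc t"
    using stopped_at_hitting_eq_if_notin(2)[OF False]
    by (intro Least_equality) (auto simp: not_less_eq_eq[symmetric])
  with False show ?thesis by (simp add: stopped_at_hitting_def[of H S "Suc t"])
qed

lemma stopped_walk_Suc:
  "stopped_at_hitting H (walk x) (Suc t) \<xi> =
    (if stopped_at_hitting H (walk x) t \<xi> \<in> H then stopped_at_hitting H (walk x) t \<xi>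
     else stopped_at_hitting H (walk x) t \<xi> + \<xi> t)"
  using stopped_at_hitting_eq_if_notin(1)[of H "walk x" t \<xi>]
  by (auto simp: stopped_at_hitting_Suc walk_def)

text \<open>Fixing the path decouples the increments: whether the walk is frozen at step
  \<open>i\<close> is read off from \<open>y i\<close>, leaving one condition on each
  \<open>\<xi> i\<close>. The path event is thus a cylinder, whose probability factorizes.\<close>

lemma stopped_walk_path_iff:
  "(\<forall>i\<le>t. stopped_at_hitting H (walk x) i \<xi> = y i) \<longleftrightarrow>
    y 0 = x \<and>
    (\<forall>i<t. \<xi> i \<in> {d. (if y i \<in> H then y i else y i + d) = y (Suc i)})"
proof (induction t)
  case 0
  show ?case by (auto simp: stopped_at_hitting_0 walk_def)
next
  case (Suc t)
  have "(\<forall>i\<le>Suc t. stopped_at_hitting H (walk x) i \<xi> = y i) \<longleftrightarrow>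
      (\<forall>i\<le>t. stopped_at_hitting H (walk x) i \<xi> = y i) \<and>
      (if y t \<in> H then y t else y t + \<xi> t) = y (Suc t)"
    unfolding le_Suc_eq using stopped_walk_Suc[of H x t \<xi>] by (metis order_refl)
  also have "\<dots> \<longleftrightarrow> y 0 = x \<and>
    (\<forall>i<Suc t. \<xi> i \<in> {d. (if y i \<in> H then y i else y i + d) = y (Suc i)})"
    unfolding Suc.IH by (auto simp: less_Suc_eq)
  finally show ?case .
qed

lemma pmf_stopped_walk_kernel:
  "pmf (stopped_walk_kernel H z) z' =
    measure (pmf_of_set {-1, 1}) {d. (if z \<in> H then z else z + d) = z'}"
proof (cases "z \<in> H")
  case True
  then show ?thesis
    by (cases "z = z'") (auto simp: stopped_walk_kernel_def)
next
  case False
  then show ?thesis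
    by (auto simp: stopped_walk_kernel_def pmf_map vimage_def)
qed

lemma space_steps_space [simp]: "space steps_space = UNIV"
  by (simp add: steps_space_def space_PiM)

lemma prob_space_steps_space: "prob_space steps_space"
  unfolding steps_space_def by (intro prob_space_PiM measure_pmf.prob_space_axioms)

lemma stopped_walk_path_probability:
  "measure steps_space {\<xi> \<in> space steps_space. \<forall>i\<le>t. stopped_at_hitting H (walk x) i \<xi> = y i} =
    path_weight x (stopped_walk_kernel H) t y"
proof -
  interpret product_prob_space "\<lambda>_. measure_pmf (pmf_of_set {-1, 1 :: int})" "UNIV :: nat set"
    by unfold_locales
  let ?F = "\<lambda>i. {d. (if y i \<in> H then y i else y i + d) = y (Suc i)}"
  have "measure steps_space {\<xi> \<in> space steps_space. \<forall>i\<in>{..<t}. \<xi> i \<in> ?F i} =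
      (\<Prod>i<t. measure (pmf_of_set {-1, 1}) (?F i))"
    unfolding steps_space_def measure_def
    by (subst emeasure_PiM_Collect) (auto simp: measure_pmf.emeasure_eq_measure prod_ennreal prod_nonneg)
  then show ?thesis
    unfolding stopped_walk_path_iff path_weight_def pmf_stopped_walk_kernel
    by (cases "y 0 = x") (simp_all only: lessThan_iff Ball_def, simp_all)
qed

lemma stopped_walk_measurable:
  "stopped_at_hitting H (walk x) t \<in> measurable steps_space (count_space UNIV)"
proof (induction t)
  case 0
  have "stopped_at_hitting H (walk x) 0 = (\<lambda>_. x)"
    by (auto simp: stopped_at_hitting_0 walk_def)
  then show ?case by simp
next
  case (Suc t)
  have coord: "(\<lambda>\<xi>. \<xi> t) \<in> measurable steps_space (count_space UNIV)"
    using measurable_component_singleton[of t UNIV "\<lambda>_. measure_pmf (pmf_of_set {-1, 1 :: int})"]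
    by (auto simp: steps_space_def measurable_def)
  \<comment> \<open>The next position depends on the current one and on a coordinate; since
    positions are countable, it suffices to treat each fixed value \<open>z\<close>.\<close>
  have step: "(\<lambda>\<xi>. if z \<in> H then z else z + \<xi> t) \<in> measurable steps_space (count_space UNIV)" for z
    by (rule measurable_compose[OF coord, of "\<lambda>d. if z \<in> H then z else z + d"]) simp
  have "stopped_at_hitting H (walk x) (Suc t) = (\<lambda>\<xi>. (\<lambda>z \<xi>. if z \<in> H then z else z + \<xi> t)
      (stopped_at_hitting H (walk x) t \<xi>) \<xi>)"
    by (simp add: stopped_walk_Suc fun_eq_iff)
  then show ?case
    using measurable_compose_countable[OF step Suc.IH] by simp
qed

lemma stopped_simple_symmetric_walkI:
  assumes "prob_space M" and "\<And>t. Y t \<in> measurable M (count_space UNIV)"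
    and "\<And>t y. measure M {\<omega> \<in> space M. \<forall>i\<le>t. Y i \<omega> = y i} =
      path_weight x (stopped_walk_kernel H) t y"
  shows "stopped_simple_symmetric_walk M H x Y"
  unfolding stopped_simple_symmetric_walk_def
proof (intro conjI allI assms(1,2))
  show "distr M (\<Pi>\<^sub>M t\<in>UNIV. count_space UNIV) (\<lambda>\<omega> t. Y t \<omega>) =
      distr steps_space (\<Pi>\<^sub>M t\<in>UNIV. count_space UNIV)
        (\<lambda>\<xi> t. stopped_at_hitting H (walk x) t \<xi>)"
    by (rule distr_eq_if_path_probabilities_eq[OF assms(1) prob_space_steps_space assms(2)
      stopped_walk_measurable]) (simp only: assms(3) stopped_walk_path_probability)
qed

subsection \<open>Uniform hands under one round of war\<close>

text \<open>Two-stage uniform sampling is uniform on pairs because every fibre has the same size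
  \<open>m\<close>; positivity of \<open>m\<close> rules out empty fibres, on which
  \<open>pmf_of_set\<close> is not meaningful.\<close>

lemma pmf_of_set_Sigma:
  assumes "finite A" "A \<noteq> {}" "\<And>x. x \<in> A \<Longrightarrow> finite (B x)" "\<And>x. x \<in> A \<Longrightarrow> card (B x) = m" "m > 0"
  shows "pmf_of_set (Sigma A B) = do {x \<leftarrow> pmf_of_set A; y \<leftarrow> pmf_of_set (B x); return_pmf (x, y)}"
proof -
  have ne: "B x \<noteq> {}" if "x \<in> A" for x using assms(4)[OF that] assms(5) by auto
  have "pmf_of_set (\<Union>x\<in>A. Pair x ` B x) = do {x \<leftarrow> pmf_of_set A; pmf_of_set (Pair x ` B x)}"
    using assms ne by (intro pmf_of_set_UN[of _ _ m])
      (auto simp: disjoint_family_on_def card_image inj_on_def)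
  also have "\<dots> = do {x \<leftarrow> pmf_of_set A; y \<leftarrow> pmf_of_set (B x); return_pmf (x, y)}"
    using assms ne by (intro bind_pmf_cong refl)
      (simp add: map_pmf_of_set_inj[symmetric] inj_on_def map_pmf_def)
  also have "(\<Union>x\<in>A. Pair x ` B x) = Sigma A B" by auto
  finally show ?thesis .
qed

lemma map_fst_pmf_of_set_Sigma:
  assumes "finite A" "A \<noteq> {}" "\<And>x. x \<in> A \<Longrightarrow> finite (B x)" "\<And>x. x \<in> A \<Longrightarrow> card (B x) = m" "m > 0"
  shows "map_pmf fst (pmf_of_set (Sigma A B)) = pmf_of_set A"
  using pmf_of_set_Sigma[of A B m] assms
  by (simp add: map_bind_pmf bind_return_pmf')

lemma pmf_of_set_bij_betw:
  assumes "bij_betw f A B" "finite A" "A \<noteq> {}"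
  shows "pmf_of_set B = map_pmf f (pmf_of_set A)"
  using assms map_pmf_of_set_inj[of f A] by (simp add: bij_betw_def)

section \<open>Uniform hands and uniform draws\<close>

definition hands :: "'c set \<Rightarrow> nat \<Rightarrow> 'c set set" where
  "hands D k = {S. S \<subseteq> D \<and> card S = k}"

definition distinct_pairs :: "'c set \<Rightarrow> ('c \<times> 'c) set" where
  "distinct_pairs S = (SIGMA a:S. S - {a})"

text \<open>Here \<open>C\<close> is what player A keeps after laying down \<open>a\<close>, and
  \<open>b\<close> is the opponent's card, so \<open>k\<close> is one less than the size of A's
  hand. In this form the two drawn cards play interchangeable roles.\<close>

definition draws :: "'c set \<Rightarrow> nat \<Rightarrow> ('c set \<times> 'c \<times> 'c) set" where
  "draws D k = (SIGMA C:hands D k. distinct_pairs (D - C))"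

lemma finite_hands [simp]: "finite D \<Longrightarrow> finite (hands D k)"
  by (simp add: hands_def)

lemma hands_eq_empty_iff [simp]: "finite D \<Longrightarrow> hands D k = {} \<longleftrightarrow> card D < k"
  using card_mono[of D] obtain_subset_with_card_n[of k D] unfolding hands_def by (auto simp: not_le[symmetric])

lemma finite_distinct_pairs [simp]: "finite S \<Longrightarrow> finite (distinct_pairs S)"
  by (simp add: distinct_pairs_def)

lemma card_distinct_pairs [simp]: "finite S \<Longrightarrow> card (distinct_pairs S) = card S * (card S - 1)"
  by (simp add: distinct_pairs_def card_SigmaI card_Diff_singleton)

lemma finite_draws [simp]: "finite D \<Longrightarrow> finite (draws D k)"
  by (auto simp: draws_def hands_def intro!: finite_SigmaI)

lemma draws_iff:
  "(C, a, b) \<in> draws D k \<longleftrightarrow> C \<subseteq> D \<and> card C = k \<and> a \<in> D - C \<and> b \<in> D - C \<and> a \<noteq> b"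
  by (auto simp: draws_def hands_def distinct_pairs_def)

lemma card_Diff_hands: "finite D \<Longrightarrow> C \<in> hands D k \<Longrightarrow> card (D - C) = card D - k"
  by (auto simp: hands_def card_Diff_subset finite_subset)

lemma hands_finite: "finite D \<Longrightarrow> A \<in> hands D k \<Longrightarrow> finite A"
  by (auto simp: hands_def finite_subset)

lemma draws_lower_hand:
  assumes "finite D" "Suc (Suc k) \<le> card D"
  shows "map_pmf (\<lambda>(C, a, b). C) (pmf_of_set (draws D k)) = pmf_of_set (hands D k)"
proof -
  have "map_pmf fst (pmf_of_set (draws D k)) = pmf_of_set (hands D k)"
    unfolding draws_def using assms
    \<comment> \<open>\<open>m\<close> counts ordered pairs of distinct cards outside
      \<open>C\<close>; it is positive since at least two cards remain there.\<close>
    by (intro map_fst_pmf_of_set_Sigma[where m = "(card D - k) * (card D - k - 1)"])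
      (auto simp: card_Diff_hands)
  then show ?thesis by (simp add: case_prod_unfold)
qed

text \<open>A triple can equally be recorded by the hand after a win together with an ordered pair
  of distinct cards inside it. Each such hand has \<open>Suc (Suc k) * Suc k\<close> pairs, so
  forgetting the pair leaves a uniform hand.\<close>

lemma draws_upper_hand:
  assumes "finite D" "Suc (Suc k) \<le> card D"
  shows "map_pmf (\<lambda>(C, a, b). insert a (insert b C)) (pmf_of_set (draws D k)) =
    pmf_of_set (hands D (Suc (Suc k)))"
proof -
  let ?T = "SIGMA A:hands D (Suc (Suc k)). distinct_pairs A"
  let ?h = "\<lambda>(A, a, b). (A - {a, b}, a, b)"
  have ne: "?T \<noteq> {}"
  proof -
    obtain A where A: "A \<in> hands D (Suc (Suc k))" using assms hands_eq_empty_iff[of D] by (metis equals0I not_le)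
    then have "card (distinct_pairs A) \<noteq> 0"
      using hands_finite[OF assms(1) A] by (auto simp: hands_def)
    then have "distinct_pairs A \<noteq> {}" by auto
    with A show ?thesis by auto
  qed
  have fin: "finite ?T" using assms hands_finite[of D] by (intro finite_SigmaI) auto
  have "bij_betw ?h ?T (draws D k)"
  proof (rule bij_betw_byWitness[where f' = "\<lambda>(C, a, b). (insert a (insert b C), a, b)"])
    show "?h ` ?T \<subseteq> draws D k"
      using card_Diff_subset[of "{_, _}"]
      by (fastforce simp: draws_iff distinct_pairs_def hands_def)
    show "(\<lambda>(C, a, b). (insert a (insert b C), a, b)) ` draws D k \<subseteq> ?T"
      using assms(1) by (auto simp: draws_iff distinct_pairs_def hands_def finite_subset card_insert_if)
  qed (auto simp: draws_iff distinct_pairs_def)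
  then have "pmf_of_set (draws D k) = map_pmf ?h (pmf_of_set ?T)"
    using fin ne by (rule pmf_of_set_bij_betw)
  then have "map_pmf (\<lambda>(C, a, b). insert a (insert b C)) (pmf_of_set (draws D k)) =
      map_pmf (\<lambda>(A, a, b). insert a (insert b (A - {a, b}))) (pmf_of_set ?T)"
    by (simp add: pmf.map_comp o_def case_prod_unfold)
  also have "\<dots> = map_pmf fst (pmf_of_set ?T)"
    using fin ne by (intro map_pmf_cong refl) (auto simp: distinct_pairs_def)
  also have "\<dots> = pmf_of_set (hands D (Suc (Suc k)))"
  proof (rule map_fst_pmf_of_set_Sigma[where m = "Suc (Suc k) * Suc k"])
    fix A assume A: "A \<in> hands D (Suc (Suc k))"
    then show "finite (distinct_pairs A)" "card (distinct_pairs A) = Suc (Suc k) * Suc k"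
      using hands_finite[OF assms(1) A] by (simp_all add: hands_def)
  qed (use assms in auto)
  finally show ?thesis .
qed

text \<open>Links the order of play to the symmetric description. All hands of size
  \<open>Suc k\<close> offer equally many choices of \<open>(a, b)\<close>, so the played triple is
  uniform, and deleting \<open>a\<close> from the hand is reversible as \<open>a\<close> is still
  recorded.\<close>

lemma draws_from_play:
  assumes "finite D" "Suc k < card D"
  shows "do {A \<leftarrow> pmf_of_set (hands D (Suc k)); a \<leftarrow> pmf_of_set A; b \<leftarrow> pmf_of_set (D - A);
      return_pmf (A - {a}, a, b)} = pmf_of_set (draws D k)"
proof -
  let ?T = "SIGMA A:hands D (Suc k). A \<times> (D - A)"
  let ?h = "\<lambda>(A, a, b). (A - {a}, a, b)"
  have finA: "finite A" if "A \<in> hands D (Suc k)" for A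
    using hands_finite assms that by blast
  have cards: "card A = Suc k" "card (D - A) = card D - Suc k" "A \<noteq> {}" "D - A \<noteq> {}"
    if "A \<in> hands D (Suc k)" for A
  proof -
    show "card A = Suc k" using that by (auto simp: hands_def)
    then show "A \<noteq> {}" by auto
    show "card (D - A) = card D - Suc k" using card_Diff_hands assms that by blast
    then show "D - A \<noteq> {}" using assms by (metis card.empty less_numeral_extra(3) zero_less_diff)
  qed
  have fin: "finite ?T" using assms finA by (intro finite_SigmaI) auto
  have "hands D (Suc k) \<noteq> {}" using assms by simp
  then have ne: "?T \<noteq> {}" using cards by blast
  have bij: "bij_betw ?h ?T (draws D k)"
  proof (rule bij_betw_byWitness[where f' = "\<lambda>(C, a, b). (insert a C, a, b)"])
    show "?h ` ?T \<subseteq> draws D k"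
      using finA by (auto simp: draws_iff hands_def card_Diff_singleton)
    show "(\<lambda>(C, a, b). (insert a C, a, b)) ` draws D k \<subseteq> ?T"
      using assms(1) by (auto simp: draws_iff hands_def finite_subset card_insert_if)
  qed (auto simp: draws_iff)
  have "pmf_of_set ?T = do {A \<leftarrow> pmf_of_set (hands D (Suc k)); z \<leftarrow> pmf_of_set (A \<times> (D - A));
      return_pmf (A, z)}"
    using assms finA cards
    by (intro pmf_of_set_Sigma[where m = "Suc k * (card D - Suc k)"]) (auto simp: card_cartesian_product)
  also have "\<dots> = do {A \<leftarrow> pmf_of_set (hands D (Suc k)); a \<leftarrow> pmf_of_set A; b \<leftarrow> pmf_of_set (D - A);
      return_pmf (A, a, b)}"
    using assms finA cards \<open>hands D (Suc k) \<noteq> {}\<close>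
    by (intro bind_pmf_cong refl)
      (auto simp: pmf_of_set_Sigma[where m = "card D - Suc k"] bind_assoc_pmf bind_return_pmf)
  finally show ?thesis
    using pmf_of_set_bij_betw[OF bij fin ne]
    by (simp add: map_bind_pmf)
qed

section \<open>Fairness from exchanging the drawn cards\<close>

lemma swap_draws:
  "bij_betw (\<lambda>(C, a, b). (C, b, a)) (draws D k) (draws D k)"
  by (rule bij_betw_byWitness[where f' = "\<lambda>(C, a, b). (C, b, a)"]) (auto simp: draws_iff)

text \<open>Reindexing by \<open>\<sigma>\<close> keeps both outcomes but turns the win weight
  \<open>q t\<close> into \<open>1 - q t\<close>. Averaging the two expressions gives weight one
  half to each outcome at every \<open>t\<close>, however \<open>q\<close> varies.\<close>

lemma bernoulli_swap_average:
  fixes T :: "'t set"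
  assumes "finite T" "T \<noteq> {}" and \<sigma>: "bij_betw \<sigma> T T"
    and q: "\<And>t. t \<in> T \<Longrightarrow> 0 \<le> q t" "\<And>t. t \<in> T \<Longrightarrow> q t + q (\<sigma> t) = 1"
    and g: "\<And>t w. t \<in> T \<Longrightarrow> g w (\<sigma> t) = g w t"
  shows "do {t \<leftarrow> pmf_of_set T; w \<leftarrow> bernoulli_pmf (q t); return_pmf (g w t)} =
    do {w \<leftarrow> bernoulli_pmf (1 / 2); t \<leftarrow> pmf_of_set T; return_pmf (g w t)}"
proof (rule pmf_eqI)
  fix y
  have \<sigma>T: "\<sigma> t \<in> T" if "t \<in> T" for t using \<sigma> that by (auto simp: bij_betw_def)
  \<comment> \<open>The upper bound on \<open>q t\<close> is the nonnegativity of
    \<open>q (\<sigma> t)\<close>.\<close>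
  have q1: "q t \<le> 1" if "t \<in> T" for t using q(1)[OF \<sigma>T[OF that]] q(2)[OF that] by linarith
  define u where "u w t = (of_bool (g w t = y) :: real)" for w t
  have ret: "pmf (return_pmf (g w t)) y = u w t" for w t by (simp add: u_def)
  have coin: "pmf (do {w \<leftarrow> bernoulli_pmf c; return_pmf (g w t)}) y = c * u True t + (1 - c) * u False t"
    if "0 \<le> c" "c \<le> 1" for c t
    using that by (simp add: pmf_bind ret[unfolded pmf_return] algebra_simps)
  have "(\<Sum>t\<in>T. q t * u True t + (1 - q t) * u False t) =
      (\<Sum>t\<in>T. q (\<sigma> t) * u True (\<sigma> t) + (1 - q (\<sigma> t)) * u False (\<sigma> t))"
    by (rule sum.reindex_bij_betw[OF \<sigma>, symmetric])
  also have "\<dots> = (\<Sum>t\<in>T. (1 - q t) * u True t + q t * u False t)"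
  proof (rule sum.cong)
    fix t assume "t \<in> T"
    then have "q (\<sigma> t) = 1 - q t" "u w (\<sigma> t) = u w t" for w
      using q(2)[of t] g by (auto simp: u_def)
    then show "q (\<sigma> t) * u True (\<sigma> t) + (1 - q (\<sigma> t)) * u False (\<sigma> t) =
        (1 - q t) * u True t + q t * u False t" by simp
  qed simp
  finally have "2 * (\<Sum>t\<in>T. q t * u True t + (1 - q t) * u False t) = (\<Sum>t\<in>T. u True t + u False t)"
    by (simp add: sum.distrib sum_subtractf algebra_simps)
  then have avg: "(\<Sum>t\<in>T. q t * u True t + (1 - q t) * u False t) =
      (\<Sum>t\<in>T. 1 / 2 * u True t + (1 - 1 / 2) * u False t)"
    by (simp add: sum.distrib sum_divide_distrib[symmetric] field_simps)
  have "pmf (do {t \<leftarrow> pmf_of_set T; w \<leftarrow> bernoulli_pmf (q t); return_pmf (g w t)}) y =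
      (\<Sum>t\<in>T. q t * u True t + (1 - q t) * u False t) / card T"
    unfolding pmf_bind[of "pmf_of_set T"] using assms(1,2) q(1) q1
    by (simp add: integral_pmf_of_set coin)
  also have "\<dots> = pmf (do {t \<leftarrow> pmf_of_set T; w \<leftarrow> bernoulli_pmf (1 / 2); return_pmf (g w t)}) y"
    unfolding pmf_bind[of "pmf_of_set T"] avg using assms(1,2)
    by (subst integral_pmf_of_set) (simp_all only: coin, simp_all)
  \<comment> \<open>The fair coin no longer depends on \<open>t\<close>, so it may be tossed before
    \<open>t\<close> is drawn.\<close>
  finally show "pmf (do {t \<leftarrow> pmf_of_set T; w \<leftarrow> bernoulli_pmf (q t); return_pmf (g w t)}) y =
      pmf (do {w \<leftarrow> bernoulli_pmf (1 / 2); t \<leftarrow> pmf_of_set T; return_pmf (g w t)}) y"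
    by (subst bind_commute_pmf)
qed

section \<open>One round of war from a uniform deal\<close>

lemma measure_uniform_le:
  assumes "0 \<le> q" "q \<le> 1"
  shows "measure (uniform_measure lborel {0..1}) {u::real. u \<le> q} = q"
proof -
  have "{0..1} \<inter> {u. u \<le> q} = {0..q}" using assms by auto
  then show ?thesis using assms by (subst measure_uniform_measure) auto
qed

text \<open>The upper bound comes from the complementary entry being nonnegative. Both bounds are
  needed to identify the chance that the uniform variable is at most \<open>p a b S\<close> with
  \<open>p a b S\<close> itself.\<close>

lemma winning_rule_range:
  assumes "winning_rule D p" "a \<in> D" "b \<in> D" "a \<noteq> b" "S \<subseteq> D - {a, b}"
  shows "0 \<le> p a b S" "p a b S \<le> 1"
proof -
  have "p a b S \<ge> 0 \<and> p a b S + p b a (D - (S \<union> {a, b})) = 1"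
    using assms by (simp add: winning_rule_def)
  moreover have "p b a (D - (S \<union> {a, b})) \<ge> 0"
    using assms(1)[unfolded winning_rule_def, rule_format, OF assms(3,2), of "D - (S \<union> {a, b})"] assms(4)
    by auto
  ultimately show "0 \<le> p a b S" "p a b S \<le> 1" by linarith+
qed

text \<open>Symmetry trades the complementary hand for \<open>S\<close> itself, so exchanging the
  two cards over the same remaining hand exchanges the odds.\<close>

lemma symmetric_rule_sum:
  assumes "winning_rule D p" "symmetric_rule D p" "a \<in> D" "b \<in> D" "a \<noteq> b" "S \<subseteq> D - {a, b}"
  shows "p a b S + p b a S = 1"
proof -
  have "p b a S = p b a (D - (S \<union> {b, a}))"
    using assms by (simp add: symmetric_rule_def insert_commute)
  moreover have "p a b S + p b a (D - (S \<union> {a, b})) = 1"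
    using assms by (simp add: winning_rule_def)
  ultimately show ?thesis by (simp add: insert_commute)
qed

text \<open>The intertwining kernel. Sizes are integers to match the values of the walk; only
  \<open>0 \<le> z \<le> card D\<close> is relevant, since larger sizes admit no hand.\<close>

definition uniform_deal :: "'c set \<Rightarrow> int \<Rightarrow> ('c set \<times> 'c set) pmf" where
  "uniform_deal D z = map_pmf (\<lambda>A. (A, D - A)) (pmf_of_set (hands D (nat z)))"

lemma draws_nonempty:
  assumes "finite D" "Suc (Suc k) \<le> card D"
  shows "draws D k \<noteq> {}"
proof -
  obtain C where C: "C \<in> hands D k"
    using assms hands_eq_empty_iff[of D k] by (metis Suc_leD equals0I not_le)
  then have "card (distinct_pairs (D - C)) \<noteq> 0"
    using assms by (simp add: card_Diff_hands)
  then have "distinct_pairs (D - C) \<noteq> {}" by auto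
  with C show ?thesis by (auto simp: draws_def)
qed

lemma war_step_uniform_hand:
  assumes "finite D" and k: "Suc k < card D" and w: "winning_rule D p" and s: "symmetric_rule D p"
  shows "bind_pmf (uniform_deal D (int (Suc k))) (war_step p) =
    do {w \<leftarrow> bernoulli_pmf (1 / 2); uniform_deal D (if w then int (Suc (Suc k)) else int k)}"
proof -
  \<comment> \<open>Written so that a win depends only on \<open>C\<close> and the unordered pair,
    and a loss only on \<open>C\<close>: both outcomes are visibly invariant under the swap.\<close>
  define g where "g = (\<lambda>w (C, a, b). if w then (insert a (insert b C), D - insert a (insert b C))
    else (C :: 'a set, D - C))"
  have "bind_pmf (uniform_deal D (int (Suc k))) (war_step p) =
      do {A \<leftarrow> pmf_of_set (hands D (Suc k)); a \<leftarrow> pmf_of_set A; b \<leftarrow> pmf_of_set (D - A);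
        w \<leftarrow> bernoulli_pmf (p a b (A - {a})); return_pmf (g w (A - {a}, a, b))}"
    unfolding uniform_deal_def map_pmf_def bind_assoc_pmf bind_return_pmf nat_int
  proof (intro bind_pmf_cong refl)
    fix A assume "A \<in> set_pmf (pmf_of_set (hands D (Suc k)))"
    then have "A \<in> hands D (Suc k)" using assms by (simp add: not_less)
    then have A: "A \<subseteq> D" "finite A" "card A = Suc k" "finite (D - A)" "card (D - A) = card D - Suc k"
      using assms(1) card_Diff_hands[of D A] hands_finite by (auto simp: hands_def)
    then have ne: "A \<noteq> {}" "D - A \<noteq> {}" using k by auto
    have "war_step p (A, D - A) = do {a \<leftarrow> pmf_of_set A; b \<leftarrow> pmf_of_set (D - A);
        w \<leftarrow> bernoulli_pmf (measure (uniform_measure lborel {0..1}) {u. u \<le> p a b (A - {a})});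
        return_pmf (if w then (A \<union> {b}, (D - A) - {b}) else (A - {a}, (D - A) \<union> {a}))}"
      unfolding war_step_def using ne by simp
    also have "\<dots> = do {a \<leftarrow> pmf_of_set A; b \<leftarrow> pmf_of_set (D - A);
        w \<leftarrow> bernoulli_pmf (p a b (A - {a})); return_pmf (g w (A - {a}, a, b))}"
    proof (intro bind_pmf_cong refl)
      fix a b assume "a \<in> set_pmf (pmf_of_set A)" "b \<in> set_pmf (pmf_of_set (D - A))"
      then have ab: "a \<in> A" "b \<in> D - A" using ne A by simp_all
      then have "0 \<le> p a b (A - {a})" "p a b (A - {a}) \<le> 1"
        using winning_rule_range[OF w, of a b "A - {a}"] A by auto
      then show "bernoulli_pmf (measure (uniform_measure lborel {0..1}) {u. u \<le> p a b (A - {a})}) =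
          bernoulli_pmf (p a b (A - {a}))"
        by (simp only: measure_uniform_le)
      fix w
      show "return_pmf (if w then (A \<union> {b}, (D - A) - {b}) else (A - {a}, (D - A) \<union> {a})) =
          return_pmf (g w (A - {a}, a, b))"
        using ab A(1) by (auto simp: g_def)
    qed
    finally show "war_step p (A, D - A) = \<dots>" .
  qed
  \<comment> \<open>Coin and outcome depend on the play only through the triple
    \<open>(A - {a}, a, b)\<close>, so the play is grouped into a single uniform draw.\<close>
  also have "\<dots> = bind_pmf (do {A \<leftarrow> pmf_of_set (hands D (Suc k)); a \<leftarrow> pmf_of_set A;
        b \<leftarrow> pmf_of_set (D - A); return_pmf (A - {a}, a, b)})
      (\<lambda>t. do {w \<leftarrow> bernoulli_pmf (case t of (C, a, b) \<Rightarrow> p a b C); return_pmf (g w t)})"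
    by (simp add: bind_assoc_pmf bind_return_pmf)
  also have "\<dots> = do {t \<leftarrow> pmf_of_set (draws D k);
      w \<leftarrow> bernoulli_pmf (case t of (C, a, b) \<Rightarrow> p a b C); return_pmf (g w t)}"
    by (subst draws_from_play[OF assms(1) k]) simp
  also have "\<dots> = do {w \<leftarrow> bernoulli_pmf (1 / 2); t \<leftarrow> pmf_of_set (draws D k); return_pmf (g w t)}"
  proof (rule bernoulli_swap_average[OF _ _ swap_draws])
    fix t assume "t \<in> draws D k"
    then obtain C a b where t: "t = (C, a, b)" and *: "a \<in> D" "b \<in> D" "a \<noteq> b" "C \<subseteq> D - {a, b}"
      by (cases t) (auto simp: draws_iff)
    show "0 \<le> (case t of (C, a, b) \<Rightarrow> p a b C)"
      using winning_rule_range[OF w *] by (simp add: t)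
    show "(case t of (C, a, b) \<Rightarrow> p a b C) +
        (case (case t of (C, a, b) \<Rightarrow> (C, b, a)) of (C, a, b) \<Rightarrow> p a b C) = 1"
      using symmetric_rule_sum[OF w s *] by (simp add: t)
    show "g w (case t of (C, a, b) \<Rightarrow> (C, b, a)) = g w t" for w
      by (simp add: g_def t insert_commute)
  qed (use assms draws_nonempty[of D k] in auto)
  also have "\<dots> = do {w \<leftarrow> bernoulli_pmf (1 / 2); uniform_deal D (if w then int (Suc (Suc k)) else int k)}"
  proof (intro bind_pmf_cong refl)
    \<comment> \<open>Given the coin, a win yields the hand with both drawn cards and a loss the
      hand with neither; each is uniform in its size.\<close>
    fix w
    have k': "Suc (Suc k) \<le> card D" using k by simp
    have "pmf_of_set (draws D k) \<bind> (\<lambda>t. return_pmf (g w t)) = map_pmf (g w) (pmf_of_set (draws D k))"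
      by (simp only: map_pmf_def)
    also have "\<dots> = uniform_deal D (if w then int (Suc (Suc k)) else int k)"
    proof (cases w)
      case True
      then have "g w = (\<lambda>A. (A, D - A)) \<circ> (\<lambda>(C, a, b). insert a (insert b C))"
        by (auto simp: g_def fun_eq_iff)
      then have "map_pmf (g w) (pmf_of_set (draws D k)) = map_pmf (\<lambda>A. (A, D - A))
          (map_pmf (\<lambda>(C, a, b). insert a (insert b C)) (pmf_of_set (draws D k)))"
        by (simp only: pmf.map_comp)
      then show ?thesis
        using True by (simp only: draws_upper_hand[OF assms(1) k'] uniform_deal_def nat_int if_True)
    next
      case False
      then have "g w = (\<lambda>A. (A, D - A)) \<circ> (\<lambda>(C, a, b). C)"
        by (auto simp: g_def fun_eq_iff)
      then have "map_pmf (g w) (pmf_of_set (draws D k)) = map_pmf (\<lambda>A. (A, D - A))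
          (map_pmf (\<lambda>(C, a, b). C) (pmf_of_set (draws D k)))"
        by (simp only: pmf.map_comp)
      then show ?thesis
        using False by (simp only: draws_lower_hand[OF assms(1) k'] uniform_deal_def nat_int if_False)
    qed
    finally show "pmf_of_set (draws D k) \<bind> (\<lambda>t. return_pmf (g w t)) =
        uniform_deal D (if w then int (Suc (Suc k)) else int k)" .
  qed
  finally show ?thesis .
qed

lemma set_uniform_deal:
  assumes "finite D" "z \<in> {0..int (card D)}"
  shows "set_pmf (uniform_deal D z) = {(A, D - A) | A. A \<subseteq> D \<and> int (card A) = z}"
proof -
  have "set_pmf (pmf_of_set (hands D (nat z))) = {A. A \<subseteq> D \<and> int (card A) = z}"
  proof (subst set_pmf_of_set)
    show "hands D (nat z) \<noteq> {}" "finite (hands D (nat z))"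
      using assms by (simp_all add: not_less nat_le_iff)
    have "card A = nat z \<longleftrightarrow> int (card A) = z" for A :: "'a set"
      using assms(2) by auto
    then show "hands D (nat z) = {A. A \<subseteq> D \<and> int (card A) = z}"
      by (simp add: hands_def)
  qed
  then show ?thesis unfolding uniform_deal_def set_map_pmf by blast
qed

lemma coin_step:
  "pmf_of_set {- 1, 1 :: int} = map_pmf (\<lambda>w. if w then 1 else - 1) (bernoulli_pmf (1 / 2))"
proof -
  have "bernoulli_pmf (1 / 2) = pmf_of_set UNIV"
    by (rule pmf_eqI) (simp add: bernoulli_pmf_half_conv_pmf_of_set)
  moreover have "(\<lambda>w. if w then 1 else - 1 :: int) ` UNIV = {-1, 1}"
    by (auto simp: UNIV_bool)
  ultimately show ?thesis
    using map_pmf_of_set_inj[of "\<lambda>w. if w then 1 else - 1 :: int" UNIV] by (simp add: inj_on_def)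
qed

lemma war_intertwining:
  assumes "finite D" and w: "winning_rule D p" "symmetric_rule D p" and z: "z \<in> {0..int (card D)}"
  shows "bind_pmf (uniform_deal D z) (war_step p) =
    bind_pmf (stopped_walk_kernel {0, int (card D)} z) (uniform_deal D)"
proof (cases "z \<in> {0, int (card D)}")
  case True
  have "bind_pmf (uniform_deal D z) (war_step p) = bind_pmf (uniform_deal D z) return_pmf"
  proof (intro bind_pmf_cong refl)
    fix s assume "s \<in> set_pmf (uniform_deal D z)"
    then obtain A where A: "s = (A, D - A)" "A \<subseteq> D" "int (card A) = z"
      using set_uniform_deal[OF assms(1) z] by auto
    \<comment> \<open>At the extreme sizes the hand is forced, and exactly these states are
      absorbing.\<close>
    then have "A = {} \<or> A = D"
      using True card_subset_eq[OF assms(1) A(2)] finite_subset[OF A(2) assms(1)] by auto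
    with A show "war_step p s = return_pmf s" by (auto simp: war_step_def)
  qed
  then show ?thesis
    using True by (auto simp: stopped_walk_kernel_def bind_return_pmf bind_return_pmf')
next
  case False
  \<comment> \<open>The size is strictly between the extremes, hence at least one, and
    \<open>nat\<close> does not truncate.\<close>
  define k where "k = nat (z - 1)"
  have k: "z = int (Suc k)" "Suc k < card D" using False z by (auto simp: k_def)
  have "bind_pmf (stopped_walk_kernel {0, int (card D)} z) (uniform_deal D) =
      do {w \<leftarrow> bernoulli_pmf (1 / 2); uniform_deal D (z + (if w then 1 else - 1))}"
    using False by (simp add: stopped_walk_kernel_def coin_step bind_map_pmf)
  also have "\<dots> = do {w \<leftarrow> bernoulli_pmf (1 / 2); uniform_deal D (if w then int (Suc (Suc k)) else int k)}"
    by (intro bind_pmf_cong refl arg_cong[of _ _ "uniform_deal D"]) (simp add: k)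
  finally show ?thesis
    using war_step_uniform_hand[OF assms(1) k(2) w] k(1) by simp
qed

section \<open>The law of the card count\<close>

theorem theorem2p1:
  fixes n A\<^sub>0 :: nat
    and D :: "'c set"
    and rank :: "'c \<Rightarrow> nat"
    and p :: "'c \<Rightarrow> 'c \<Rightarrow> 'c set \<Rightarrow> real"
    and M :: "'w measure"
    and X :: "nat \<Rightarrow> 'w \<Rightarrow> 'c set \<times> 'c set"
  assumes "n \<ge> 1"
    and "finite D" and "card D = 2 * n"
    and "\<forall>c\<in>D. rank c \<in> {1..2 * n}"
    and "winning_rule D p" and "symmetric_rule D p"
    and "war_game M D p X"
    and "A\<^sub>0 \<in> {0..2 * n}"
    and "distr M (count_space UNIV) (\<lambda>\<omega>. fst (X 0 \<omega>)) =
      measure_pmf (pmf_of_set {S. S \<subseteq> D \<and> card S = A\<^sub>0})"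
  shows "stopped_simple_symmetric_walk M {0, 2 * int n} (int A\<^sub>0)
    (\<lambda>t \<omega>. int (card (fst (X t \<omega>))))"
proof (rule stopped_simple_symmetric_walkI)
  have chain: "markov_chain M (war_states D) (war_step p) X"
    using assms(7) by (simp add: war_game_def)
  then interpret prob_space M by (simp add: markov_chain_def)
  show "prob_space M" by (rule prob_space_axioms)
  have X: "X t \<in> measurable M (count_space (war_states D))" for t
    using chain by (simp add: markov_chain_def)
  have X_states: "X t \<omega> \<in> war_states D" if "\<omega> \<in> space M" for t \<omega>
    using measurable_space[OF X that] by simp
  show "(\<lambda>\<omega>. int (card (fst (X t \<omega>)))) \<in> measurable M (count_space UNIV)" for t
    by (rule measurable_compose[OF X]) simp
  have states: "war_states D = (\<lambda>A. (A, D - A)) ` Pow D"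
    by (auto simp: war_states_def)
  let ?I = "{0..int (card D)}"
  have card_D: "int (card D) = 2 * int n" using assms(3) by simp
  \<comment> \<open>The hypothesis gives the law of the first hand only; on legal states the second
    hand is its complement, so the full initial state is determined.\<close>
  have X0: "measure M {\<omega> \<in> space M. X 0 \<omega> = s} = pmf (uniform_deal D (int A\<^sub>0)) s" for s
  proof (cases "s \<in> war_states D")
    case True
    then obtain A where A: "s = (A, D - A)" by (auto simp: states)
    have "{\<omega> \<in> space M. X 0 \<omega> = s} = (\<lambda>\<omega>. fst (X 0 \<omega>)) -` {A} \<inter> space M"
    proof (intro set_eqI iffI)
      fix \<omega> assume "\<omega> \<in> (\<lambda>\<omega>. fst (X 0 \<omega>)) -` {A} \<inter> space M"
      then show "\<omega> \<in> {\<omega> \<in> space M. X 0 \<omega> = s}"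
        using X_states[of \<omega> 0] by (auto simp: A states)
    qed (simp add: A)
    also have "measure M \<dots> = measure (distr M (count_space UNIV) (\<lambda>\<omega>. fst (X 0 \<omega>))) {A}"
      by (rule measure_distr[symmetric]) (auto intro: measurable_compose[OF X])
    also have "\<dots> = pmf (pmf_of_set (hands D A\<^sub>0)) A"
      by (simp only: assms(9) hands_def pmf.rep_eq)
    also have "\<dots> = pmf (uniform_deal D (int A\<^sub>0)) s"
      unfolding uniform_deal_def A nat_int
      by (rule pmf_map_inj'[symmetric, where f = "\<lambda>A. (A, D - A)"]) (auto simp: inj_on_def)
    finally show ?thesis .
  next
    case False
    then have "s \<notin> set_pmf (uniform_deal D (int A\<^sub>0))"
      using set_uniform_deal[of D "int A\<^sub>0"] assms by (auto simp: states)
    then have "pmf (uniform_deal D (int A\<^sub>0)) s = 0" by (simp add: pmf_eq_0_set_pmf)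
    moreover have "{\<omega> \<in> space M. X 0 \<omega> = s} = {}" using X_states False by auto
    ultimately show ?thesis by (simp only: measure_empty)
  qed
  have fin: "finite (war_states D)" using assms(2) by (simp add: states)
  have card_I: "(\<lambda>s. int (card (fst s))) ` war_states D \<subseteq> ?I"
    using card_mono[OF assms(2)] by (auto simp: states)
  have A0: "int A\<^sub>0 \<in> ?I" using assms by simp
  have deal_states: "set_pmf (uniform_deal D z) \<subseteq> war_states D" if "z \<in> ?I" for z
    using set_uniform_deal[OF assms(2) that] by (auto simp: states)
  have deal_card: "int (card (fst s)) = z" if "z \<in> ?I" "s \<in> set_pmf (uniform_deal D z)" for s z
    using that(2) set_uniform_deal[OF assms(2) that(1)] by auto
  \<comment> \<open>The walk moves only from interior sizes, so a unit step cannot leave the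
    interval.\<close>
  have kernel_I: "set_pmf (stopped_walk_kernel {0, 2 * int n} z) \<subseteq> ?I" if "z \<in> ?I" for z
    using that card_D by (auto simp: stopped_walk_kernel_def)
  have intertw: "bind_pmf (uniform_deal D z) (war_step p) =
      bind_pmf (stopped_walk_kernel {0, 2 * int n} z) (uniform_deal D)" if "z \<in> ?I" for z
    using war_intertwining[OF assms(2,5,6) that] by (simp only: card_D)
  show "measure M {\<omega> \<in> space M. \<forall>i\<le>t. int (card (fst (X i \<omega>))) = y i} =
      path_weight (int A\<^sub>0) (stopped_walk_kernel {0, 2 * int n}) t y" for t y
    by (rule intertwining_path_probability[where f = "\<lambda>s. int (card (fst s))",
      OF chain fin deal_states deal_card kernel_I intertw A0 X0 card_I])
qed

end
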